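(* Let $\Delta:\mathbb{M}_2(\mathbb{C})\to \mathbb{M}_2(\mathbb{C})\otimes\mathbb{M}_2(\mathbb{C})$ be a quantum quadratic operator for which the normalized trace $\tau$ is a Haar state. Expand, for $i=1,2,3$, $$\Delta(\sigma_i)=b_i(\mathbf 1\otimes \mathbf 1)+\sum_{j=1}^3 b_{ji}^{(1)}(\mathbf 1\otimes \sigma_j)+\sum_{j=1}^3 b_{ji}^{(2)}(\sigma_j\otimes \mathbf 1)+\sum_{m,l=1}^3 b_{ml,i}(\sigma_m\otimes\sigma_l)$$ with complex coefficients. Then $b_j=0$, $b^{(1)}_{ij}=b^{(2)}_{ij}=0$, and $b_{ij,k}$ is real for all $i,j,k\in\{1,2,3\}$. Moreover, for every $x=w_0\mathbf 1+\mathbf w\sigma\in \mathbb{M}_2(\mathbb{C})$, $$\Delta(x)=w_0\,\mathbf 1\otimes \mathbf 1+\sum_{m,l=1}^3\langle \mathbf b_{ml},\overline{\mathbf w}\rangle\,\sigma_m\otimes\sigma_l,\qquad \mathbf b_{ml}=(b_{ml,1},b_{ml,2},b_{ml,3}).$$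
   Context: $\mathbb{M}_2(\mathbb{C})$ is the algebra of complex $2\times2$ matrices and $\mathbf 1$ its identity; $\mathbb{M}_2(\mathbb{C})\otimes\mathbb{M}_2(\mathbb{C})\cong\mathbb{M}_4(\mathbb{C})$. A linear map $\Delta:\mathbb{M}_2(\mathbb{C})\to \mathbb{M}_2(\mathbb{C})\otimes\mathbb{M}_2(\mathbb{C})$ is a quantum quadratic operator (q.q.o.) if $\Delta\mathbf 1=\mathbf 1\otimes\mathbf 1$ and $\Delta x\ge0$ whenever $x\ge 0$. A state $h$ on $\mathbb{M}_2(\mathbb{C})$ (positive linear functional with $h(\mathbf 1)=1$) is a Haar state for $\Delta$ if $(h\otimes id)\circ\Delta(x)=(id\otimes h)\circ\Delta(x)=h(x)\mathbf 1$ for all $x\in\mathbb{M}_2(\mathbb{C})$. $\tau(x)=\frac12\mathrm{Tr}(x)$ is the normalized trace. The Pauli matrices are $\sigma_1=\begin{pmatrix}0&1\\1&0\end{pmatrix}$, $\sigma_2=\begin{pmatrix}0&-i\\ i&0\end{pmatrix}$, $\sigma_3=\begin{pmatrix}1&0\\0&-1\end{pmatrix}$; every $x\in\mathbb{M}_2(\mathbb{C})$ is uniquely $x=w_0\mathbf 1+\mathbf w\sigma$ with $w_0\in\mathbb{C}$, $\mathbf w=(w_1,w_2,w_3)\in\mathbb{C}^3$, $\mathbf w\sigma=w_1\sigma_1+w_2\sigma_2+w_3\sigma_3$; $\overline{\mathbf w}=(\overline{w_1},\overline{w_2},\overline{w_3})$. $\langle \mathbf u,\mathbf v\rangle=\sum_k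 u_k\overline{v_k}$ is the standard scalar product on $\mathbb{C}^3$. *)

theory Defs
  imports "HOL-Analysis.Analysis"
begin

text \<open>
  \<open>M\<^sub>2(\<complex>) \<otimes> M\<^sub>2(\<complex>)\<close> is realised as \<open>M\<^sub>4(\<complex>)\<close> through the Kronecker product, with rows and
  columns indexed by pairs, so that the tensor factors remain visible in the index type.
\<close>

type_synonym M2 = "complex ^ 2 ^ 2"
type_synonym M2M2 = "complex ^ (2 \<times> 2) ^ (2 \<times> 2)"

definition kron :: "M2 \<Rightarrow> M2 \<Rightarrow> M2M2" (infixr \<open>\<otimes>\<^sub>K\<close> 75) where
  "a \<otimes>\<^sub>K b = (\<chi> p q. a $ fst p $ fst q * b $ snd p $ snd q)"

text \<open>The library's \<open>*s\<close> scales a nested vector by a row, hence a separate complex scaling of matrices.\<close>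

definition mscale :: "complex \<Rightarrow> complex ^ 'n ^ 'm \<Rightarrow> complex ^ 'n ^ 'm" (infixr \<open>*\<^sub>C\<close> 75) where
  "c *\<^sub>C A = (\<chi> i j. c * A $ i $ j)"

lemma vector_space_mscale: "vector_space (mscale :: complex \<Rightarrow> complex ^ 'n ^ 'm \<Rightarrow> _)"
  by unfold_locales (simp_all add: mscale_def vec_eq_iff algebra_simps)

text \<open>Over \<open>\<complex>\<close> the condition on the quadratic form already forces \<open>A\<close> to be self-adjoint.\<close>

definition positive_mat :: "complex ^ 'n ^ 'n \<Rightarrow> bool" where
  "positive_mat A \<longleftrightarrow> (\<forall>v :: complex ^ 'n. (\<Sum>i\<in>UNIV. (A *v v) $ i * cnj (v $ i)) \<in> \<real>\<^sub>\<ge>\<^sub>0)"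

definition qqo :: "(M2 \<Rightarrow> M2M2) \<Rightarrow> bool" where
  "qqo \<Delta> \<longleftrightarrow>
     Vector_Spaces.linear mscale mscale \<Delta> \<and>
     \<Delta> (mat 1) = mat 1 \<otimes>\<^sub>K mat 1 \<and>
     (\<forall>x. positive_mat x \<longrightarrow> positive_mat (\<Delta> x))"

definition state :: "(M2 \<Rightarrow> complex) \<Rightarrow> bool" where
  "state h \<longleftrightarrow>
     Vector_Spaces.linear mscale (*) h \<and>
     (\<forall>x. positive_mat x \<longrightarrow> h x \<in> \<real>\<^sub>\<ge>\<^sub>0) \<and>
     h (mat 1) = 1"

text \<open>
  \<open>h \<otimes> id\<close> and \<open>id \<otimes> h\<close>, identifying \<open>\<complex> \<otimes> M\<^sub>2(\<complex>)\<close> and \<open>M\<^sub>2(\<complex>) \<otimes> \<complex>\<close> with \<open>M\<^sub>2(\<complex>)\<close>: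
  \<open>h\<close> is applied to the blocks obtained by fixing the indices of the other factor. For linear \<open>h\<close>
  the values on elementary tensors are given by the lemmas \<open>tensor_id_kron\<close> and \<open>id_tensor_kron\<close>.
\<close>

definition tensor_id :: "(M2 \<Rightarrow> complex) \<Rightarrow> M2M2 \<Rightarrow> M2" where
  "tensor_id h X = (\<chi> k l. h (\<chi> i j. X $ (i, k) $ (j, l)))"

definition id_tensor :: "(M2 \<Rightarrow> complex) \<Rightarrow> M2M2 \<Rightarrow> M2" where
  "id_tensor h X = (\<chi> i j. h (\<chi> k l. X $ (i, k) $ (j, l)))"

lemma linear_tensor_id:
  assumes "Vector_Spaces.linear mscale (*) h"
  shows "Vector_Spaces.linear mscale mscale (tensor_id h)"
proof -
  have add: "h (x + y) = h x + h y" and scale: "h (c *\<^sub>C x) = c * h x" for x y c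
    using assms by (simp_all add: Vector_Spaces.linear_iff)
  have "tensor_id h (X + Y) = tensor_id h X + tensor_id h Y" for X Y
    by (simp add: tensor_id_def vec_eq_iff flip: add) (simp add: plus_vec_def)
  moreover have "tensor_id h (c *\<^sub>C X) = c *\<^sub>C tensor_id h X" for c X
    by (simp add: tensor_id_def mscale_def vec_eq_iff flip: scale)
  ultimately show ?thesis
    by (simp add: Vector_Spaces.linear_iff vector_space_mscale)
qed

lemma linear_id_tensor:
  assumes "Vector_Spaces.linear mscale (*) h"
  shows "Vector_Spaces.linear mscale mscale (id_tensor h)"
proof -
  have add: "h (x + y) = h x + h y" and scale: "h (c *\<^sub>C x) = c * h x" for x y c
    using assms by (simp_all add: Vector_Spaces.linear_iff)
  have "id_tensor h (X + Y) = id_tensor h X + id_tensor h Y" for X Y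
    by (simp add: id_tensor_def vec_eq_iff flip: add) (simp add: plus_vec_def)
  moreover have "id_tensor h (c *\<^sub>C X) = c *\<^sub>C id_tensor h X" for c X
    by (simp add: id_tensor_def mscale_def vec_eq_iff flip: scale)
  ultimately show ?thesis
    by (simp add: Vector_Spaces.linear_iff vector_space_mscale)
qed

lemma tensor_id_kron:
  assumes "Vector_Spaces.linear mscale (*) h"
  shows "tensor_id h (a \<otimes>\<^sub>K b) = h a *\<^sub>C b"
proof -
  have scale: "h (c *\<^sub>C x) = c * h x" for x c
    using assms by (simp add: Vector_Spaces.linear_iff)
  have "(\<chi> i j. (a \<otimes>\<^sub>K b) $ (i, k) $ (j, l)) = (b $ k $ l) *\<^sub>C a" for k l
    by (simp add: kron_def mscale_def vec_eq_iff)
  then show ?thesis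
    by (simp add: tensor_id_def scale) (simp add: mscale_def mult.commute)
qed

lemma id_tensor_kron:
  assumes "Vector_Spaces.linear mscale (*) h"
  shows "id_tensor h (a \<otimes>\<^sub>K b) = h b *\<^sub>C a"
proof -
  have scale: "h (c *\<^sub>C x) = c * h x" for x c
    using assms by (simp add: Vector_Spaces.linear_iff)
  have "(\<chi> k l. (a \<otimes>\<^sub>K b) $ (i, k) $ (j, l)) = (a $ i $ j) *\<^sub>C b" for i j
    by (simp add: kron_def mscale_def vec_eq_iff)
  then show ?thesis
    by (simp add: id_tensor_def scale) (simp add: mscale_def mult.commute)
qed

definition haar_state :: "(M2 \<Rightarrow> M2M2) \<Rightarrow> (M2 \<Rightarrow> complex) \<Rightarrow> bool" where
  "haar_state \<Delta> h \<longleftrightarrow>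
     state h \<and>
     (\<forall>x. tensor_id h (\<Delta> x) = h x *\<^sub>C mat 1 \<and> id_tensor h (\<Delta> x) = h x *\<^sub>C mat 1)"

definition tau :: "M2 \<Rightarrow> complex" where
  "tau x = trace x / 2"

text \<open>The last case is \<open>\<sigma> 3\<close>; in the type \<open>3\<close> of integers modulo 3, \<open>3 = 0\<close>.\<close>

definition pauli :: "3 \<Rightarrow> M2" (\<open>\<sigma>\<close>) where
  "\<sigma> k =
    (if k = 1 then vector [vector [0, 1], vector [1, 0]]
     else if k = 2 then vector [vector [0, - \<i>], vector [\<i>, 0]]
     else vector [vector [1, 0], vector [0, -1]])"

definition cvec_inner :: "complex ^ 'n \<Rightarrow> complex ^ 'n \<Rightarrow> complex" where
  "cvec_inner u v = (\<Sum>k\<in>UNIV. u $ k * cnj (v $ k))"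

definition cvec_cnj :: "complex ^ 'n \<Rightarrow> complex ^ 'n" where
  "cvec_cnj v = (\<chi> k. cnj (v $ k))"

text \<open>
  Every element of \<open>M\<^sub>2(\<complex>) \<otimes> M\<^sub>2(\<complex>)\<close> has a Pauli expansion, so a hypothesis that names the
  coefficients of one is no restriction.
\<close>

lemma pauli_expansion_exists:
  "\<exists>c u v t. X =
     c *\<^sub>C (mat 1 \<otimes>\<^sub>K mat 1)
     + (\<Sum>j\<in>UNIV. u j *\<^sub>C (mat 1 \<otimes>\<^sub>K \<sigma> j))
     + (\<Sum>j\<in>UNIV. v j *\<^sub>C (\<sigma> j \<otimes>\<^sub>K mat 1))
     + (\<Sum>m\<in>UNIV. \<Sum>l\<in>UNIV. t m l *\<^sub>C (\<sigma> m \<otimes>\<^sub>K \<sigma> l))"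
proof -
  define T where "T Y = (\<Sum>p\<in>UNIV. \<Sum>q\<in>UNIV. X $ p $ q * Y $ q $ p) / 4" for Y :: M2M2
  have UNIV22: "(UNIV :: (2 \<times> 2) set) = {(1,1), (1,2), (2,1), (2,2)}"
    by (auto simp: UNIV_2 simp flip: UNIV_Times_UNIV)
  have "X =
      T (mat 1 \<otimes>\<^sub>K mat 1) *\<^sub>C (mat 1 \<otimes>\<^sub>K mat 1)
      + (\<Sum>j\<in>UNIV. T (mat 1 \<otimes>\<^sub>K \<sigma> j) *\<^sub>C (mat 1 \<otimes>\<^sub>K \<sigma> j))
      + (\<Sum>j\<in>UNIV. T (\<sigma> j \<otimes>\<^sub>K mat 1) *\<^sub>C (\<sigma> j \<otimes>\<^sub>K mat 1))
      + (\<Sum>m\<in>UNIV. \<Sum>l\<in>UNIV. T (\<sigma> m \<otimes>\<^sub>K \<sigma> l) *\<^sub>C (\<sigma> m \<otimes>\<^sub>K \<sigma> l))"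
    by (simp add: T_def UNIV22 vec_eq_iff forall_2 split_paired_All
        kron_def mscale_def pauli_def sum_3 mat_def field_simps)
  then show ?thesis by (intro exI)
qed

end

theory Submission
  imports Defs
begin

text \<open>
  Applying \<open>\<tau> \<otimes> id\<close> and \<open>id \<otimes> \<tau>\<close> to \<open>\<Delta> (\<sigma> i)\<close> gives \<open>\<tau> (\<sigma> i) = 0\<close> times the identity, while on the Pauli
  expansion it erases every term that is traceless in the respective factor; so the coefficients
  other than \<open>bb\<close> vanish by linear independence. Since \<open>1 + \<sigma> i\<close> is positive, \<open>\<Delta> (\<sigma> i)\<close> is a
  difference of positive, hence self-adjoint, matrices, and its coefficients are real as traces of
  products of two self-adjoint matrices. The formula for \<open>\<Delta> x\<close> is then linearity.
\<close>

definition hermitian :: "complex ^ 'n ^ 'n \<Rightarrow> bool" where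
  "hermitian A \<longleftrightarrow> (\<forall>i j. cnj (A $ i $ j) = A $ j $ i)"

lemma hermitian_diff: "hermitian A \<Longrightarrow> hermitian B \<Longrightarrow> hermitian (A - B)"
  by (simp add: hermitian_def)

lemma hermitian_kron: "hermitian a \<Longrightarrow> hermitian c \<Longrightarrow> hermitian (a \<otimes>\<^sub>K c)"
  by (simp add: hermitian_def kron_def)

lemma hermitian_pauli: "hermitian (\<sigma> k)"
  by (auto simp: hermitian_def pauli_def forall_2)

text \<open>A test vector supported on coordinates \<open>i\<close> and \<open>j\<close> sees only
  four entries of \<open>A\<close>. The identity also covers \<open>i = j\<close>, where the two
  axis vectors add up, so its use below is free of case distinctions.\<close>

lemma quadratic_form_axis:
  fixes A :: "complex ^ 'n ^ 'n" and c d :: complex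
  shows "(\<Sum>k\<in>UNIV. (A *v (axis i c + axis j d)) $ k * cnj ((axis i c + axis j d) $ k)) =
    A $ i $ i * c * cnj c + A $ i $ j * d * cnj c + A $ j $ i * c * cnj d + A $ j $ j * d * cnj d"
proof -
  have apply_axis: "(A *v axis m e) $ k = A $ k $ m * e" for k m e
    by (simp add: matrix_vector_mult_def axis_def if_distrib cong: if_cong)
  have pick: "(\<Sum>k\<in>UNIV. f k * cnj (axis m e $ k)) = f m * cnj e" for f :: "'n \<Rightarrow> complex" and m e
    by (simp add: axis_def if_distrib cong: if_cong)
  show ?thesis
    by (simp add: matrix_vector_right_distrib distrib_left sum.distrib pick apply_axis)
      (simp add: algebra_simps)
qed

text \<open>Polarisation: the form is tested on \<open>e\<^sub>i\<close>, \<open>e\<^sub>i + e\<^sub>j\<close> and \<open>e\<^sub>i + \<i> e\<^sub>j\<close>.\<close>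

lemma positive_mat_imp_hermitian:
  assumes "positive_mat A"
  shows "hermitian A"
proof -
  have real: "Im (A $ i $ i * c * cnj c + A $ i $ j * d * cnj c
      + A $ j $ i * c * cnj d + A $ j $ j * d * cnj d) = 0" for i j c d
    using assms [unfolded positive_mat_def, rule_format, of "axis i c + axis j d"]
    unfolding quadratic_form_axis by (simp only: complex_nonneg_Reals_iff)
  have diag: "Im (A $ i $ i) = 0" for i
    using real [of i 1 i 0] by simp
  \<comment> \<open>With a real diagonal and \<open>c = 1\<close>, the choice \<open>d = 1\<close>
    makes the imaginary parts of the two entries opposite, and \<open>d = \<i>\<close> makes their
    real parts equal.\<close>
  have "cnj (A $ i $ j) = A $ j $ i" for i j
    using real [of i 1 j 1] real [of i 1 j \<i>] diag [of i] diag [of j]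
    by (simp add: complex_eq_iff)
  then show ?thesis
    by (simp add: hermitian_def)
qed

text \<open>The double sum is the trace of the product. Conjugation transposes both factors, which
  merely exchanges the two summation indices.\<close>

lemma trace_hermitian_mult_real:
  assumes "hermitian A" "hermitian B"
  shows "(\<Sum>p\<in>UNIV. \<Sum>q\<in>UNIV. A $ p $ q * B $ q $ p) \<in> \<real>"
proof -
  have "cnj (\<Sum>p\<in>UNIV. \<Sum>q\<in>UNIV. A $ p $ q * B $ q $ p) = (\<Sum>p\<in>UNIV. \<Sum>q\<in>UNIV. A $ q $ p * B $ p $ q)"
    using assms by (simp add: hermitian_def)
  also have "\<dots> = (\<Sum>p\<in>UNIV. \<Sum>q\<in>UNIV. A $ p $ q * B $ q $ p)"
    by (rule sum.swap)
  finally show ?thesis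
    by (simp add: Reals_cnj_iff)
qed

lemma mult_cnj_nonneg: "z * cnj z \<in> \<real>\<^sub>\<ge>\<^sub>0"
  by (simp add: complex_nonneg_Reals_iff)

lemma positive_mat_one: "positive_mat (mat 1)"
  by (auto simp: positive_mat_def complex_nonneg_Reals_iff intro!: sum_nonneg)

text \<open>Each such matrix is twice a rank-one projection, namely onto the eigenvector of
  \<open>\<sigma> k\<close> for eigenvalue 1, so its quadratic form is a nonnegative multiple of the
  squared modulus of one linear form.\<close>

lemma positive_mat_one_add_pauli: "positive_mat (mat 1 + \<sigma> k)"
proof -
  have "(\<Sum>i\<in>UNIV. ((mat 1 + \<sigma> k) *v v) $ i * cnj (v $ i)) =
     (if k = 1 then (v $ 1 + v $ 2) * cnj (v $ 1 + v $ 2)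
      else if k = 2 then (v $ 1 - \<i> * v $ 2) * cnj (v $ 1 - \<i> * v $ 2)
      else 2 * (v $ 1 * cnj (v $ 1)))" for v
    by (simp add: matrix_vector_mult_def pauli_def sum_2 mat_def algebra_simps)
  then show ?thesis
    by (simp only: positive_mat_def mult_cnj_nonneg nonneg_Reals_mult_I nonneg_Reals_numeral_I
        split: if_split) blast
qed

text \<open>The diagonal entries are \<open>c + u 3\<close> and \<open>c - u 3\<close>, the
  off-diagonal ones \<open>u 1 - \<i> * u 2\<close> and \<open>u 1 + \<i> * u 2\<close>; sums and
  differences isolate each coefficient.\<close>

lemma pauli_independent:
  assumes "c *\<^sub>C mat 1 + (\<Sum>j\<in>UNIV. u j *\<^sub>C \<sigma> j) = 0"
  shows "c = 0" and "u j = 0"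
proof -
  have "(c *\<^sub>C mat 1 + (\<Sum>j\<in>UNIV. u j *\<^sub>C \<sigma> j)) $ p $ q = 0" for p q
    using assms by simp
  from this [of 1 1] this [of 1 2] this [of 2 1] this [of 2 2]
  have "c + u 3 = 0" "c - u 3 = 0" "u 1 - \<i> * u 2 = 0" "u 1 + \<i> * u 2 = 0"
    by (simp_all add: sum_3 mscale_def pauli_def mat_def mult.commute)
  moreover have "2 * c = (c + u 3) + (c - u 3)" "2 * u 3 = (c + u 3) - (c - u 3)"
    "2 * u 1 = (u 1 - \<i> * u 2) + (u 1 + \<i> * u 2)"
    "2 * \<i> * u 2 = (u 1 + \<i> * u 2) - (u 1 - \<i> * u 2)"
    by simp_all
  ultimately have "2 * c = 0" "2 * u 3 = 0" "2 * u 1 = 0" "2 * \<i> * u 2 = 0"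
    by (simp_all only: add_0 diff_0_right)
  then have "c = 0 \<and> (\<forall>j. u j = 0)"
    by (simp add: forall_3)
  then show "c = 0" "u j = 0"
    by blast+
qed

text \<open>The products \<open>\<sigma> m \<otimes>\<^sub>K \<sigma> l\<close> are orthogonal for
  the trace form, and each has square of trace 4.\<close>

lemma pauli_tensor_coefficient:
  assumes "X = (\<Sum>m\<in>UNIV. \<Sum>l\<in>UNIV. t m l *\<^sub>C (\<sigma> m \<otimes>\<^sub>K \<sigma> l))"
  shows "t m l = (\<Sum>p\<in>UNIV. \<Sum>q\<in>UNIV. X $ p $ q * (\<sigma> m \<otimes>\<^sub>K \<sigma> l) $ q $ p) / 4"
proof -
  have UNIV22: "(UNIV :: (2 \<times> 2) set) = {(1,1), (1,2), (2,1), (2,2)}"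
    by (auto simp: UNIV_2 simp flip: UNIV_Times_UNIV)
  \<comment> \<open>Quantifying over both indices lets \<open>forall_3\<close> split the claim into
    nine concrete cases.\<close>
  have "\<forall>m l. t m l = (\<Sum>p\<in>UNIV. \<Sum>q\<in>UNIV. X $ p $ q * (\<sigma> m \<otimes>\<^sub>K \<sigma> l) $ q $ p) / 4"
    unfolding forall_3 assms
    by (simp add: UNIV22 kron_def mscale_def pauli_def sum_3 field_simps)
  then show ?thesis
    by blast
qed

lemma linear_tau: "Vector_Spaces.linear mscale (*) tau"
  by (simp add: Vector_Spaces.linear_iff vector_space_mscale vector_space_over_itself.vector_space_axioms)
    (simp add: tau_def trace_def mscale_def sum.distrib sum_distrib_left add_divide_distrib)

lemma tau_one: "tau (mat 1) = 1"
  by (simp add: tau_def trace_def mat_def)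

lemma tau_pauli: "tau (\<sigma> k) = 0"
  by (simp add: tau_def trace_def pauli_def sum_2)

theorem proposition3p2:
  fixes \<Delta> :: "M2 \<Rightarrow> M2M2"
    and b :: "3 \<Rightarrow> complex"
    and b1 b2 :: "3 \<Rightarrow> 3 \<Rightarrow> complex"
    and bb :: "3 \<Rightarrow> 3 \<Rightarrow> 3 \<Rightarrow> complex"
  assumes "qqo \<Delta>"
    and "haar_state \<Delta> tau"
    and expansion: "\<And>i. \<Delta> (\<sigma> i) =
          b i *\<^sub>C (mat 1 \<otimes>\<^sub>K mat 1)
          + (\<Sum>j\<in>UNIV. b1 j i *\<^sub>C (mat 1 \<otimes>\<^sub>K \<sigma> j))
          + (\<Sum>j\<in>UNIV. b2 j i *\<^sub>C (\<sigma> j \<otimes>\<^sub>K mat 1))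
          + (\<Sum>m\<in>UNIV. \<Sum>l\<in>UNIV. bb m l i *\<^sub>C (\<sigma> m \<otimes>\<^sub>K \<sigma> l))"
  shows "(\<forall>j. b j = 0) \<and>
    (\<forall>i j. b1 i j = 0 \<and> b2 i j = 0) \<and>
    (\<forall>i j k. bb i j k \<in> \<real>) \<and>
    (\<forall>(w0 :: complex) (w :: complex ^ 3).
        \<Delta> (w0 *\<^sub>C mat 1 + (\<Sum>k\<in>UNIV. (w $ k) *\<^sub>C \<sigma> k)) =
          w0 *\<^sub>C (mat 1 \<otimes>\<^sub>K mat 1)
          + (\<Sum>m\<in>UNIV. \<Sum>l\<in>UNIV.
               cvec_inner (\<chi> k. bb m l k) (cvec_cnj w) *\<^sub>C (\<sigma> m \<otimes>\<^sub>K \<sigma> l)))"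
proof -
  have lin: "Vector_Spaces.linear mscale mscale \<Delta>"
    and unit: "\<Delta> (mat 1) = mat 1 \<otimes>\<^sub>K mat 1"
    and pos: "\<And>x. positive_mat x \<Longrightarrow> positive_mat (\<Delta> x)"
    using assms(1) by (simp_all add: qqo_def)
  interpret D: Vector_Spaces.linear mscale mscale \<Delta>
    by (rule lin)
  interpret TI: Vector_Spaces.linear mscale mscale "tensor_id tau"
    by (rule linear_tensor_id [OF linear_tau])
  interpret IT: Vector_Spaces.linear mscale mscale "id_tensor tau"
    by (rule linear_id_tensor [OF linear_tau])
  note kron_simps = tensor_id_kron [OF linear_tau] id_tensor_kron [OF linear_tau] tau_one tau_pauli
  have zero: "0 *\<^sub>C A = 0" and one: "1 *\<^sub>C A = A" for A :: "complex ^ 'n ^ 'm"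
    by (simp_all add: mscale_def vec_eq_iff)
  have scale_zero: "c *\<^sub>C (0 :: M2) = 0" for c
    by (simp add: mscale_def vec_eq_iff)
  have haar: "tensor_id tau (\<Delta> (\<sigma> i)) = 0" "id_tensor tau (\<Delta> (\<sigma> i)) = 0" for i
    using assms(2) by (simp_all add: haar_state_def tau_pauli zero)
  \<comment> \<open>Tracing out the first factor keeps the terms with \<open>b\<close> and
    \<open>b1\<close>; tracing out the second, in \<open>right\<close>, keeps those with
    \<open>b\<close> and \<open>b2\<close>.\<close>
  have left: "b i *\<^sub>C mat 1 + (\<Sum>j\<in>UNIV. b1 j i *\<^sub>C \<sigma> j) = 0" for i
    using haar(1) [of i]
    by (simp add: expansion TI.add TI.sum TI.scale kron_simps zero one scale_zero)
  have right: "b i *\<^sub>C mat 1 + (\<Sum>j\<in>UNIV. b2 j i *\<^sub>C \<sigma> j) = 0" for i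
    using haar(2) [of i]
    by (simp add: expansion IT.add IT.sum IT.scale kron_simps zero one scale_zero)
  have b0: "b i = 0" "b1 j i = 0" "b2 j i = 0" for i j
    using pauli_independent [OF left] pauli_independent [OF right] by blast+
  have image_pauli: "\<Delta> (\<sigma> i) = (\<Sum>m\<in>UNIV. \<Sum>l\<in>UNIV. bb m l i *\<^sub>C (\<sigma> m \<otimes>\<^sub>K \<sigma> l))" for i
    by (simp add: expansion b0 zero)
  have "hermitian (\<Delta> (\<sigma> i))" for i
  proof -
    have "\<Delta> (\<sigma> i) = \<Delta> (mat 1 + \<sigma> i) - \<Delta> (mat 1)"
      by (simp add: D.add)
    then show ?thesis
      using pos [OF positive_mat_one_add_pauli] pos [OF positive_mat_one]
      by (simp add: hermitian_diff positive_mat_imp_hermitian)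
  qed
  then have real: "bb m l i \<in> \<real>" for m l i
    unfolding pauli_tensor_coefficient [OF image_pauli]
    by (intro Reals_divide trace_hermitian_mult_real hermitian_kron hermitian_pauli) simp_all
  have "\<Delta> (w0 *\<^sub>C mat 1 + (\<Sum>k\<in>UNIV. (w $ k) *\<^sub>C \<sigma> k)) =
      w0 *\<^sub>C (mat 1 \<otimes>\<^sub>K mat 1)
      + (\<Sum>m\<in>UNIV. \<Sum>l\<in>UNIV.
           cvec_inner (\<chi> k. bb m l k) (cvec_cnj w) *\<^sub>C (\<sigma> m \<otimes>\<^sub>K \<sigma> l))" for w0 and w :: "complex ^ 3"
  proof -
    \<comment> \<open>The conjugation in the second argument of \<open>cvec_inner\<close> cancels
      \<open>cvec_cnj\<close>, leaving the bilinear sum of \<open>bb m l k * w $ k\<close> over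
      \<open>k\<close>.\<close>
    have "(\<Sum>k\<in>UNIV. (w $ k) *\<^sub>C \<Delta> (\<sigma> k)) =
        (\<Sum>m\<in>UNIV. \<Sum>l\<in>UNIV. cvec_inner (\<chi> k. bb m l k) (cvec_cnj w) *\<^sub>C (\<sigma> m \<otimes>\<^sub>K \<sigma> l))"
      by (simp add: image_pauli cvec_inner_def cvec_cnj_def sum_3 vec_eq_iff mscale_def algebra_simps)
    then show ?thesis
      by (simp add: D.add D.scale D.sum unit)
  qed
  then show ?thesis
    using b0 real by blast
qed

end
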